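(* Let $(\mathfrak g,J,g)$ be a four dimensional Kähler Lie algebra for which there exists an abelian ideal $\mathfrak h$ and a short exact sequence of Lie algebras (not necessarily split) $0\to\mathfrak h\to\mathfrak g\to\mathfrak k\to0$, where $\mathfrak g=\mathfrak h\oplus\mathfrak k$ as vector spaces, the subspace $\mathfrak k$ is identified with the quotient $\mathfrak g/\mathfrak h$, and $\mathfrak h$ and $\mathfrak k$ are $J$-invariant totally isotropic subspaces of $\mathfrak g$. Then the (neutral) metric $g$ is a Walker metric.
   Context: All Lie algebras are real. A complex structure on $\mathfrak g$ is an endomorphism $J$ with $J^2=-I$ and $[Jx,Jy]-[x,y]-J[Jx,y]-J[x,Jy]=0$. A Kähler Lie algebra is a Lie algebra with a complex structure $J$ and a closed nondegenerate 2-form $\omega$ (closed: $\omega([x,y],z)+\omega([y,z],x)+\omega([z,x],y)=0$) with $\omega(Jx,Jy)=\omega(x,y)$; the associated pseudo-Kähler metric is $g(x,y)=\omega(Jx,y)$, and one writes $(\mathfrak g,J,g)$. A subspace $W$ is totally isotropic if $W=W^\perp$ (orthogonal with respect to $g$). The Levi-Civita connection of $g$ on $\mathfrak g$ is given by $2g(\nabla_xy,z)=g([x,y],z)-g([y,z],x)+g([z,x],y)$. A pseudo-Riemannian metric $g$ on $\mathfrak g$ is a Walker metric if there exists a nonzero subspace $W\subset\mathfrak g$ with $g(W,W)=0$ and $\nabla_yW\subset W$ for all $y\in\mathfrak g$. *)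

theory Defs
  imports "HOL-Analysis.Analysis"
begin

text \<open>A real Lie algebra is given by a subspace \<open>V\<close> of a real vector space (possibly \<open>UNIV\<close>)
  and a bracket, of which only the values on \<open>V\<close> matter.\<close>

definition lie_algebra_on :: "'a::real_vector set \<Rightarrow> ('a \<Rightarrow> 'a \<Rightarrow> 'a) \<Rightarrow> bool" where
  "lie_algebra_on V br \<longleftrightarrow>
     subspace V \<and>
     (\<forall>x\<in>V. \<forall>y\<in>V. br x y \<in> V) \<and>
     (\<forall>x\<in>V. \<forall>y\<in>V. \<forall>z\<in>V. br (x + y) z = br x z + br y z \<and> br z (x + y) = br z x + br z y) \<and>
     (\<forall>x\<in>V. \<forall>y\<in>V. \<forall>c. br (c *\<^sub>R x) y = c *\<^sub>R br x y \<and> br x (c *\<^sub>R y) = c *\<^sub>R br x y) \<and>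
     (\<forall>x\<in>V. br x x = 0) \<and>
     (\<forall>x\<in>V. \<forall>y\<in>V. \<forall>z\<in>V. br (br x y) z + br (br y z) x + br (br z x) y = 0)"

definition lie_hom_on ::
  "'a::real_vector set \<Rightarrow> ('a \<Rightarrow> 'a \<Rightarrow> 'a) \<Rightarrow> 'b::real_vector set \<Rightarrow> ('b \<Rightarrow> 'b \<Rightarrow> 'b) \<Rightarrow> ('a \<Rightarrow> 'b) \<Rightarrow> bool"
where
  "lie_hom_on V br V' br' f \<longleftrightarrow>
     f ` V \<subseteq> V' \<and>
     (\<forall>x\<in>V. \<forall>y\<in>V. f (x + y) = f x + f y) \<and>
     (\<forall>x\<in>V. \<forall>c. f (c *\<^sub>R x) = c *\<^sub>R f x) \<and>
     (\<forall>x\<in>V. \<forall>y\<in>V. f (br x y) = br' (f x) (f y))"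

definition lie_short_exact ::
  "'a::real_vector set \<Rightarrow> ('a \<Rightarrow> 'a \<Rightarrow> 'a) \<Rightarrow> ('a \<Rightarrow> 'b) \<Rightarrow> 'b::real_vector set \<Rightarrow> ('b \<Rightarrow> 'b \<Rightarrow> 'b) \<Rightarrow>
   ('b \<Rightarrow> 'c) \<Rightarrow> 'c::real_vector set \<Rightarrow> ('c \<Rightarrow> 'c \<Rightarrow> 'c) \<Rightarrow> bool"
where
  "lie_short_exact A brA i B brB p C brC \<longleftrightarrow>
     lie_algebra_on A brA \<and> lie_algebra_on B brB \<and> lie_algebra_on C brC \<and>
     lie_hom_on A brA B brB i \<and> lie_hom_on B brB C brC p \<and>
     inj_on i A \<and> i ` A = {x \<in> B. p x = 0} \<and> p ` B = C"

definition abelian_ideal :: "('a::real_vector \<Rightarrow> 'a \<Rightarrow> 'a) \<Rightarrow> 'a set \<Rightarrow> bool" where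
  "abelian_ideal br h \<longleftrightarrow>
     subspace h \<and> (\<forall>x. \<forall>y\<in>h. br x y \<in> h) \<and> (\<forall>x\<in>h. \<forall>y\<in>h. br x y = 0)"

definition direct_sum_decomposition :: "'a::real_vector set \<Rightarrow> 'a set \<Rightarrow> bool" where
  "direct_sum_decomposition V W \<longleftrightarrow>
     subspace V \<and> subspace W \<and> V \<inter> W = {0} \<and> {x + y | x y. x \<in> V \<and> y \<in> W} = UNIV"

definition complex_structure :: "('a::real_vector \<Rightarrow> 'a \<Rightarrow> 'a) \<Rightarrow> ('a \<Rightarrow> 'a) \<Rightarrow> bool" where
  "complex_structure br J \<longleftrightarrow>
     linear J \<and> (\<forall>x. J (J x) = - x) \<and>
     (\<forall>x y. br (J x) (J y) - br x y - J (br (J x) y) - J (br x (J y)) = 0)"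

definition nondegenerate :: "('a::real_vector \<Rightarrow> 'a \<Rightarrow> real) \<Rightarrow> bool" where
  "nondegenerate b \<longleftrightarrow> (\<forall>x. (\<forall>y. b x y = 0) \<longrightarrow> x = 0)"

definition closed_2form :: "('a::real_vector \<Rightarrow> 'a \<Rightarrow> 'a) \<Rightarrow> ('a \<Rightarrow> 'a \<Rightarrow> real) \<Rightarrow> bool" where
  "closed_2form br \<omega> \<longleftrightarrow>
     bilinear \<omega> \<and> (\<forall>x. \<omega> x x = 0) \<and>
     (\<forall>x y z. \<omega> (br x y) z + \<omega> (br y z) x + \<omega> (br z x) y = 0)"

definition kahler_lie_algebra ::
  "('a::real_vector \<Rightarrow> 'a \<Rightarrow> 'a) \<Rightarrow> ('a \<Rightarrow> 'a) \<Rightarrow> ('a \<Rightarrow> 'a \<Rightarrow> real) \<Rightarrow> bool"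
where
  "kahler_lie_algebra br J \<omega> \<longleftrightarrow>
     lie_algebra_on UNIV br \<and> complex_structure br J \<and>
     closed_2form br \<omega> \<and> nondegenerate \<omega> \<and> (\<forall>x y. \<omega> (J x) (J y) = \<omega> x y)"

definition pseudo_kahler_metric ::
  "('a::real_vector \<Rightarrow> 'a) \<Rightarrow> ('a \<Rightarrow> 'a \<Rightarrow> real) \<Rightarrow> 'a \<Rightarrow> 'a \<Rightarrow> real"
where
  "pseudo_kahler_metric J \<omega> x y = \<omega> (J x) y"

definition pseudo_riemannian_metric :: "('a::real_vector \<Rightarrow> 'a \<Rightarrow> real) \<Rightarrow> bool" where
  "pseudo_riemannian_metric g \<longleftrightarrow> bilinear g \<and> (\<forall>x y. g x y = g y x) \<and> nondegenerate g"

definition orth :: "('a::real_vector \<Rightarrow> 'a \<Rightarrow> real) \<Rightarrow> 'a set \<Rightarrow> 'a set" where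
  "orth g W = {x. \<forall>w\<in>W. g x w = 0}"

text \<open>The convention is \<open>W = W\<^sup>\<bottom>\<close>, not merely \<open>W \<subseteq> W\<^sup>\<bottom>\<close>.\<close>

definition totally_isotropic :: "('a::real_vector \<Rightarrow> 'a \<Rightarrow> real) \<Rightarrow> 'a set \<Rightarrow> bool" where
  "totally_isotropic g W \<longleftrightarrow> subspace W \<and> W = orth g W"

text \<open>\<open>levi_civita br g x y\<close> is \<open>\<nabla>\<^sub>x y\<close>; lemma \<open>levi_civita_koszul\<close> below shows that the description
  is proper in finite dimension.\<close>

definition levi_civita ::
  "('a::real_vector \<Rightarrow> 'a \<Rightarrow> 'a) \<Rightarrow> ('a \<Rightarrow> 'a \<Rightarrow> real) \<Rightarrow> 'a \<Rightarrow> 'a \<Rightarrow> 'a"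
where
  "levi_civita br g x y =
     (THE v. \<forall>z. 2 * g v z = g (br x y) z - g (br y z) x + g (br z x) y)"

definition walker_metric ::
  "('a::real_vector \<Rightarrow> 'a \<Rightarrow> 'a) \<Rightarrow> ('a \<Rightarrow> 'a \<Rightarrow> real) \<Rightarrow> bool"
where
  "walker_metric br g \<longleftrightarrow>
     pseudo_riemannian_metric g \<and>
     (\<exists>W. subspace W \<and> W \<noteq> {0} \<and> (\<forall>u\<in>W. \<forall>v\<in>W. g u v = 0) \<and>
          (\<forall>y. \<forall>w\<in>W. levi_civita br g y w \<in> W))"

text \<open>Neutral means signature \<open>(m, m)\<close>.\<close>

definition neutral_metric :: "('a::real_vector \<Rightarrow> 'a \<Rightarrow> real) \<Rightarrow> bool" where
  "neutral_metric g \<longleftrightarrow>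
     pseudo_riemannian_metric g \<and>
     (\<exists>P N. direct_sum_decomposition P N \<and> dim P = dim N \<and>
        (\<forall>x\<in>P. \<forall>y\<in>N. g x y = 0) \<and>
        (\<forall>x\<in>P. x \<noteq> 0 \<longrightarrow> g x x > 0) \<and> (\<forall>x\<in>N. x \<noteq> 0 \<longrightarrow> g x x < 0))"

lemma metric_represents_functional:
  fixes g :: "'a::real_vector \<Rightarrow> 'a \<Rightarrow> real"
  assumes dim: "dim (UNIV :: 'a set) > 0"
    and g: "pseudo_riemannian_metric g" and f: "linear f"
  shows "\<exists>!v. \<forall>z. g v z = f z"
proof -
  obtain B :: "'a set" where B: "independent B" "span B = UNIV" "card B = dim (UNIV :: 'a set)"
    by (metis basis_exists span_UNIV span_eq top_greatest dim_span)
  with dim have fin: "finite B" by (metis card.infinite less_irrefl)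
  interpret F: finite_dimensional_vector_space "(*\<^sub>R) :: real \<Rightarrow> 'a \<Rightarrow> 'a" B
    using B fin by unfold_locales (auto simp: dependent_raw_def span_raw_def)
  have bil: "bilinear g" and nd: "nondegenerate g"
    using g by (auto simp: pseudo_riemannian_metric_def)
  have l1: "linear (g x)" and l2: "linear (\<lambda>x. g x y)" for x y
    using bil by (auto simp: bilinear_def)
  define T where "T x = (\<Sum>b\<in>B. g x b *\<^sub>R b)" for x
  have linT: "linear T"
    unfolding T_def using l2
    by (intro linear_compose_sum ballI linear_compose_scale_right) (auto simp: linear_iff scaleR_left_distrib)
  have coeff: "c b = d b" if "(\<Sum>b\<in>B. c b *\<^sub>R b) = (\<Sum>b\<in>B. d b *\<^sub>R b)" "b \<in> B" for c d b
  proof -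
    have "(\<Sum>b\<in>B. (c b - d b) *\<^sub>R b) = 0"
      using that(1) by (simp add: scaleR_left_diff_distrib sum_subtractf)
    then have "c b - d b = 0" using independentD[OF B(1) fin subset_refl _ that(2)] by fast
    then show ?thesis by simp
  qed
  have eqB: "p = q" if "linear p" "linear q" "\<And>b. b \<in> B \<Longrightarrow> p b = q b" for p q :: "'a \<Rightarrow> real"
    using linear_eq_on[OF that(1,2)] that(3) B(2) by (metis UNIV_I ext)
  have uniq: "x = y" if "\<And>z. g x z = g y z" for x y
  proof -
    have "g (x - y) z = 0" for z using that linear_diff[OF l2] by simp
    then have "x - y = 0" using nd unfolding nondegenerate_def by blast
    then show ?thesis by simp
  qed
  have "inj T"
  proof (rule injI)
    fix x y assume "T x = T y"
    then have "g x b = g y b" if "b \<in> B" for b using coeff[of "g x" "g y"] that by (simp add: T_def)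
    then have "g x = g y" using eqB[OF l1 l1] by blast
    then show "x = y" using uniq by simp
  qed
  then have "surj T" using F.linear_inj_imp_surj[of T] linT by (simp add: linear_def)
  then obtain v where "T v = (\<Sum>b\<in>B. f b *\<^sub>R b)" by (metis surjD)
  then have "g v b = f b" if "b \<in> B" for b using coeff[of "g v" f] that by (simp add: T_def)
  then have "g v = f" using eqB[OF l1 f] by blast
  then show ?thesis using uniq by (metis)
qed

lemma levi_civita_koszul:
  fixes br :: "'a::real_vector \<Rightarrow> 'a \<Rightarrow> 'a"
  assumes dim: "dim (UNIV :: 'a set) > 0"
    and br: "lie_algebra_on UNIV br" and g: "pseudo_riemannian_metric g"
  shows "2 * g (levi_civita br g x y) z = g (br x y) z - g (br y z) x + g (br z x) y"
proof -
  let ?r = "\<lambda>z. g (br x y) z - g (br y z) x + g (br z x) y"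
  have bil: "bilinear g" using g by (simp add: pseudo_riemannian_metric_def)
  have "linear (\<lambda>z. ?r z / 2)"
    using br by (intro linearI)
      (simp_all add: lie_algebra_on_def bilinear_ladd[OF bil] bilinear_radd[OF bil]
        bilinear_lmul[OF bil] bilinear_rmul[OF bil] field_simps)
  from metric_represents_functional[OF dim g this]
  have "\<exists>!v. \<forall>z. 2 * g v z = ?r z"
    by (simp add: field_simps)
  from theI'[OF this] show ?thesis by (simp add: levi_civita_def)
qed

end

theory Submission
  imports Defs
begin

text \<open>The parallel isotropic subspace is the abelian ideal \<open>\<hh>\<close> itself. As \<open>\<hh>\<close> is its own
  orthogonal space, \<open>\<nabla>\<^sub>y w\<close> lies in \<open>\<hh>\<close> as soon as it is orthogonal to every \<open>z \<in> \<hh>\<close>. For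
  \<open>w, z \<in> \<hh>\<close> the Koszul formula reads
  \<open>2 g (\<nabla>\<^sub>y w) z = g [y, w] z - g [w, z] y + g [z, y] w\<close>; the middle term vanishes because \<open>\<hh>\<close>
  is abelian, and the outer terms pair two elements of the isotropic space \<open>\<hh>\<close>, because \<open>\<hh>\<close> is an
  ideal (\<open>levi_civita_mem_isotropic_abelian_ideal\<close>).

  Neutrality is linear algebra (\<open>neutral_metric_of_isotropic_decomposition\<close>): two complementary
  isotropic subspaces \<open>\<hh>\<close> and \<open>\<kk>\<close> are put in duality by the metric. A basis of \<open>\<hh>\<close> and the dual
  basis of \<open>\<kk>\<close> give a linear map \<open>T\<close> from \<open>\<hh>\<close> onto \<open>\<kk>\<close> for which \<open>g (T x) y\<close> is an inner product
  on \<open>\<hh>\<close>; the graphs of \<open>T\<close> and of \<open>- T\<close> are then orthogonal to each other, the metric is positive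
  on the first and negative on the second, and both have the dimension of \<open>\<hh>\<close>.\<close>

section \<open>The metric of a Kaehler Lie algebra\<close>

text \<open>Invariance of \<open>\<omega>\<close> under \<open>J\<close> turns the antisymmetry of \<open>\<omega>\<close> into symmetry of
  \<open>\<omega> (J x) y\<close>: indeed \<open>\<omega> (J x) y = \<omega> (J (J x)) (J y) = - \<omega> x (J y) = \<omega> (J y) x\<close>.\<close>

lemma pseudo_riemannian_pseudo_kahler_metric:
  assumes "kahler_lie_algebra br J \<omega>"
  shows "pseudo_riemannian_metric (pseudo_kahler_metric J \<omega>)"
proof -
  have lin: "linear J" and JJ: "\<And>x. J (J x) = - x" and bil: "bilinear \<omega>"
    and alt: "\<And>x. \<omega> x x = 0" and inv: "\<And>x y. \<omega> (J x) (J y) = \<omega> x y"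
    and nd: "\<And>x. (\<And>y. \<omega> x y = 0) \<Longrightarrow> x = 0"
    using assms by (auto simp: kahler_lie_algebra_def complex_structure_def closed_2form_def
        nondegenerate_def)
  have anti: "\<omega> x y = - \<omega> y x" for x y
  proof -
    have "\<omega> (x + y) (x + y) = \<omega> x y + \<omega> y x"
      by (simp add: alt[of x] alt[of y] bilinear_ladd[OF bil] bilinear_radd[OF bil])
    then show ?thesis using alt[of "x + y"] by linarith
  qed
  have "\<omega> (J x) y = \<omega> (J y) x" for x y
    using inv[of "J x" y] anti[of x "J y"] by (simp add: JJ bilinear_lneg[OF bil])
  moreover have "bilinear (\<lambda>x y. \<omega> (J x) y)"
    using bil linear_compose[OF lin] by (auto simp: bilinear_def o_def)
  moreover have "x = 0" if "\<And>y. \<omega> (J x) y = 0" for x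
    using nd[OF that] JJ[of x] linear_0[OF lin] by simp
  ultimately show ?thesis
    by (simp add: pseudo_riemannian_metric_def pseudo_kahler_metric_def[abs_def] nondegenerate_def)
qed

section \<open>Complementary isotropic subspaces\<close>

lemma direct_sum_decompositionE:
  assumes "direct_sum_decomposition V W"
  obtains v w where "v \<in> V" "w \<in> W" "x = v + w"
proof -
  have "x \<in> {v + w | v w. v \<in> V \<and> w \<in> W}"
    using assms by (simp add: direct_sum_decomposition_def)
  then show ?thesis using that by blast
qed

lemma dim_linear_image_eq:
  fixes f :: "'a::real_vector \<Rightarrow> 'b::real_vector"
  assumes "linear f" "subspace V" "inj_on f V"
  shows "dim (f ` V) = dim V"
proof -
  obtain B where B: "B \<subseteq> V" "independent B" "V \<subseteq> span B" "card B = dim V"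
    by (rule basis_exists)
  then have span: "span B = V" using assms(2) by (simp add: span_minimal subset_antisym)
  have "independent (f ` B)"
    using linear_independent_injective_image[OF assms(1) B(2)] assms(3) span by simp
  moreover have "span (f ` B) = f ` V" using linear_span_image[OF assms(1)] span by simp
  ultimately have "dim (f ` V) = card (f ` B)"
    using dim_eq_card_independent[of "f ` B"] dim_span[of "f ` B"] by simp
  then show ?thesis using B(4) card_image[OF inj_on_subset[OF assms(3) B(1)]] by simp
qed

lemma bilinear_diagonal_sum:
  fixes \<beta> :: "'a::real_vector \<Rightarrow> 'a \<Rightarrow> real"
  assumes bil: "bilinear \<beta>" and fin: "finite B"
    and diag: "\<And>b c. b \<in> B \<Longrightarrow> c \<in> B \<Longrightarrow> \<beta> b c = (if b = c then 1 else 0)"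
  shows "\<beta> (\<Sum>b\<in>B. s b *\<^sub>R b) (\<Sum>b\<in>B. t b *\<^sub>R b) = (\<Sum>b\<in>B. s b * t b)"
proof -
  have "\<beta> (\<Sum>b\<in>B. s b *\<^sub>R b) (\<Sum>c\<in>B. t c *\<^sub>R c) = (\<Sum>b\<in>B. \<Sum>c\<in>B. s b * t c * \<beta> b c)"
    by (simp add: bilinear_sum[OF bil] sum.cartesian_product[symmetric]
        bilinear_lmul[OF bil] bilinear_rmul[OF bil] mult.assoc mult.left_commute)
  also have "\<dots> = (\<Sum>b\<in>B. \<Sum>c\<in>B. if b = c then s b * t c else 0)"
    by (intro sum.cong refl) (simp add: diag)
  finally show ?thesis using fin by simp
qed

text \<open>The map \<open>T\<close> sends a basis of \<open>V\<close> to the dual basis of \<open>W\<close>, so that \<open>g (T x) y\<close> is the standard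
  inner product of coordinates on \<open>V\<close>.\<close>

lemma isotropic_complement_duality:
  fixes g :: "'a::real_vector \<Rightarrow> 'a \<Rightarrow> real"
  assumes dim: "dim (UNIV :: 'a set) > 0" and g: "pseudo_riemannian_metric g"
    and dec: "direct_sum_decomposition V W"
    and isoV: "\<And>x y. x \<in> V \<Longrightarrow> y \<in> V \<Longrightarrow> g x y = 0"
    and isoW: "\<And>x y. x \<in> W \<Longrightarrow> y \<in> W \<Longrightarrow> g x y = 0"
  obtains T where "linear T" "T ` V = W"
    "\<And>x y. x \<in> V \<Longrightarrow> y \<in> V \<Longrightarrow> g (T x) y = g (T y) x"
    "\<And>x. x \<in> V \<Longrightarrow> x \<noteq> 0 \<Longrightarrow> g (T x) x > 0"
proof -
  have bil: "bilinear g" and nd: "\<And>x. (\<And>y. g x y = 0) \<Longrightarrow> x = 0"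
    using g by (auto simp: pseudo_riemannian_metric_def nondegenerate_def)
  have subV: "subspace V" and subW: "subspace W"
    using dec by (auto simp: direct_sum_decomposition_def)
  obtain E :: "'a set" where E: "independent E" "span E = UNIV" "card E = dim (UNIV :: 'a set)"
    by (metis basis_exists span_UNIV span_eq top_greatest dim_span)
  with dim have "finite E" by (metis card.infinite less_irrefl)
  then interpret F: finite_dimensional_vector_space "(*\<^sub>R) :: real \<Rightarrow> 'a \<Rightarrow> 'a" E
    using E by unfold_locales (auto simp: dependent_raw_def span_raw_def)
  obtain B where B: "B \<subseteq> V" "independent B" "V \<subseteq> span B"
    by (rule maximal_independent_subset)
  have fin: "finite B"
    using F.finiteI_independent[of B] B(2) by (simp add: dependent_raw_def)
  have spanB: "span B = V" using B(1,3) subV by (simp add: span_minimal subset_antisym)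
  have dual: "\<exists>w\<in>W. \<forall>c\<in>B. g w c = (if b = c then 1 else 0)" if "b \<in> B" for b
  proof -
    obtain f :: "'a \<Rightarrow> real" where f: "linear f" "\<forall>c\<in>B. f c = (if b = c then 1 else 0)"
      using linear_independent_extend[OF B(2), of "\<lambda>c. if b = c then 1 else 0"] by blast
    obtain u where u: "\<forall>z. g u z = f z" using metric_represents_functional[OF dim g f(1)] by blast
    \<comment> \<open>The component of \<open>u\<close> in \<open>V\<close> pairs to zero with \<open>V\<close>, so dropping it keeps the functional on
      \<open>B\<close> and moves its representative into \<open>W\<close>.\<close>
    obtain v w where vw: "v \<in> V" "w \<in> W" "u = v + w" by (rule direct_sum_decompositionE[OF dec])
    have "g w c = (if b = c then 1 else 0)" if c: "c \<in> B" for c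
    proof -
      have "g u c = g w c"
        using isoV[OF vw(1), of c] c B(1) by (auto simp: vw(3) bilinear_ladd[OF bil])
      then show ?thesis using bspec[OF f(2) c] spec[OF u, of c] by simp
    qed
    then show ?thesis using vw(2) by blast
  qed
  then have "\<exists>d. \<forall>b\<in>B. d b \<in> W \<and> (\<forall>c\<in>B. g (d b) c = (if b = c then 1 else 0))"
    by (intro bchoice) blast
  then obtain d where d: "\<And>b. b \<in> B \<Longrightarrow> d b \<in> W"
    "\<And>b c. b \<in> B \<Longrightarrow> c \<in> B \<Longrightarrow> g (d b) c = (if b = c then 1 else 0)" by blast
  obtain T where T: "linear T" "\<forall>b\<in>B. T b = d b"
    using linear_independent_extend[OF B(2)] by blast
  have bilT: "bilinear (\<lambda>x y. g (T x) y)"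
    using bil linear_compose[OF T(1)] by (auto simp: bilinear_def o_def)
  have TW: "T x \<in> W" if "x \<in> V" for x
  proof -
    have "T x \<in> span (T ` B)" using that spanB by (simp add: linear_span_image[OF T(1)])
    also have "\<dots> \<subseteq> W" using T(2) d(1) subW by (intro span_minimal) auto
    finally show ?thesis .
  qed
  have coords: "\<exists>s. x = (\<Sum>b\<in>B. s b *\<^sub>R b)" if "x \<in> V" for x
    using that span_finite[OF fin] spanB by auto
  have gT: "g (T (\<Sum>b\<in>B. s b *\<^sub>R b)) (\<Sum>b\<in>B. t b *\<^sub>R b) = (\<Sum>b\<in>B. s b * t b)" for s t
    using bilinear_diagonal_sum[OF bilT fin] T(2) d(2) by simp
  have sym: "g (T x) y = g (T y) x" if "x \<in> V" "y \<in> V" for x y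
    using coords[OF that(1)] coords[OF that(2)] by (auto simp: gT mult.commute)
  have pos: "g (T x) x > 0" if x: "x \<in> V" "x \<noteq> 0" for x
  proof -
    obtain s where s: "x = (\<Sum>b\<in>B. s b *\<^sub>R b)" using coords[OF x(1)] by blast
    have "\<exists>b\<in>B. s b \<noteq> 0"
    proof (rule ccontr)
      assume "\<not> (\<exists>b\<in>B. s b \<noteq> 0)"
      then show False using x(2) by (simp add: s)
    qed
    then obtain b where "b \<in> B" "s b \<noteq> 0" by blast
    then have "(\<Sum>b\<in>B. s b * s b) > 0" using fin
      by (intro sum_pos2[of B b]) (auto simp: zero_less_mult_iff)
    then show ?thesis by (simp add: s gT)
  qed
  have "w \<in> T ` V" if w: "w \<in> W" for w
  proof -
    \<comment> \<open>The dual-basis expansion of \<open>w\<close>.\<close>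
    define x where "x = (\<Sum>b\<in>B. g w b *\<^sub>R b)"
    have x: "x \<in> V" unfolding x_def using B(1) subV by (intro subspace_sum subspace_scale) auto
    have "g (w - T x) z = 0" for z
    proof -
      obtain v w' where vw: "v \<in> V" "w' \<in> W" "z = v + w'" by (rule direct_sum_decompositionE[OF dec])
      obtain t where t: "v = (\<Sum>b\<in>B. t b *\<^sub>R b)" using coords[OF vw(1)] by blast
      have "linear (g w)" using bil by (simp add: bilinear_def)
      then have "g w v = (\<Sum>b\<in>B. g w b * t b)"
        by (simp add: t linear_sum linear_scale mult.commute)
      also have "\<dots> = g (T x) v" by (simp only: x_def t gT)
      finally show ?thesis
        using vw isoW[OF w vw(2)] isoW[OF TW[OF x] vw(2)]
        by (simp add: bilinear_lsub[OF bil] bilinear_radd[OF bil])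
    qed
    then show ?thesis using nd[of "w - T x"] x by auto
  qed
  then have "T ` V = W" using TW by auto
  then show ?thesis using that T(1) sym pos by blast
qed

text \<open>With \<open>T\<close> as in the previous lemma, the positive and the negative definite subspace are
  \<open>{x + T x | x \<in> V}\<close> and \<open>{x - T x | x \<in> V}\<close>, since
  \<open>g (x + T x) (x + T x) = 2 g (T x) x\<close>, \<open>g (x - T x) (x - T x) = - 2 g (T x) x\<close> and
  \<open>g (x + T x) (y - T y) = g (T x) y - g (T y) x = 0\<close>.\<close>

lemma neutral_metric_of_isotropic_decomposition:
  fixes g :: "'a::real_vector \<Rightarrow> 'a \<Rightarrow> real"
  assumes dim: "dim (UNIV :: 'a set) > 0" and g: "pseudo_riemannian_metric g"
    and dec: "direct_sum_decomposition V W"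
    and isoV: "\<And>x y. x \<in> V \<Longrightarrow> y \<in> V \<Longrightarrow> g x y = 0"
    and isoW: "\<And>x y. x \<in> W \<Longrightarrow> y \<in> W \<Longrightarrow> g x y = 0"
  shows "neutral_metric g"
proof -
  obtain T where T: "linear T" "T ` V = W"
    and Tsym: "\<And>x y. x \<in> V \<Longrightarrow> y \<in> V \<Longrightarrow> g (T x) y = g (T y) x"
    and Tpos: "\<And>x. x \<in> V \<Longrightarrow> x \<noteq> 0 \<Longrightarrow> g (T x) x > 0"
    using isotropic_complement_duality[OF assms] by blast
  have bil: "bilinear g" and sym: "\<And>x y. g x y = g y x"
    using g by (auto simp: pseudo_riemannian_metric_def)
  have subV: "subspace V" using dec by (simp add: direct_sum_decomposition_def)
  have TW: "T x \<in> W" if "x \<in> V" for x using T(2) that by auto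
  define A where "A x = x + T x" for x
  define C where "C x = x - T x" for x
  have linA: "linear A" and linC: "linear C"
    unfolding A_def C_def using T(1) by (auto intro: linear_compose_add linear_compose_sub linear_ident)
  have gAA: "g (A x) (A x) = 2 * g (T x) x" if "x \<in> V" for x
    using that isoV[of x x] isoW[of "T x" "T x"] TW sym[of x "T x"]
    by (simp add: A_def bilinear_ladd[OF bil] bilinear_radd[OF bil])
  have gCC: "g (C x) (C x) = - (2 * g (T x) x)" if "x \<in> V" for x
    using that isoV[of x x] isoW[of "T x" "T x"] TW sym[of x "T x"]
    by (simp add: C_def bilinear_lsub[OF bil] bilinear_rsub[OF bil])
  have gAC: "g (A x) (C y) = 0" if "x \<in> V" "y \<in> V" for x y
    using that isoV[of x y] isoW[of "T x" "T y"] TW sym[of x "T y"] Tsym[of x y]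
    by (simp add: A_def C_def bilinear_ladd[OF bil] bilinear_rsub[OF bil])
  have pos: "g u u > 0" if "u \<in> A ` V" "u \<noteq> 0" for u
    using that Tpos gAA linear_0[OF linA] by force
  have neg: "g u u < 0" if "u \<in> C ` V" "u \<noteq> 0" for u
    using that Tpos gCC linear_0[OF linC] by force
  have ker: "x = 0" if "x \<in> V" "A x = 0 \<or> C x = 0" for x
    using that Tpos[of x] gAA[of x] gCC[of x] bilinear_lzero[OF bil] by force
  have "inj_on A V" and "inj_on C V"
    using ker subV by (auto simp: linear_injective_on_subspace_0[OF linA]
        linear_injective_on_subspace_0[OF linC])
  then have "dim (A ` V) = dim V" and "dim (C ` V) = dim V"
    using subV by (simp_all add: dim_linear_image_eq[OF linA] dim_linear_image_eq[OF linC])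
  then have "dim (A ` V) = dim (C ` V)" by simp
  moreover have "direct_sum_decomposition (A ` V) (C ` V)"
  proof -
    have "A ` V \<inter> C ` V = {0}"
    proof -
      have "u = 0" if "u \<in> A ` V" "u \<in> C ` V" for u using pos[of u] neg[of u] that by fastforce
      moreover have "0 \<in> A ` V" "0 \<in> C ` V"
        using subspace_0[OF subV] linear_0[OF linA] linear_0[OF linC] by (metis image_eqI)+
      ultimately show ?thesis by blast
    qed
    moreover have "\<exists>x\<in>A ` V. \<exists>y\<in>C ` V. z = x + y" for z
    proof -
      obtain v w where "v \<in> V" "w \<in> W" "z = v + w"
        by (rule direct_sum_decompositionE[OF dec])
      then obtain v' where v: "v \<in> V" "v' \<in> V" "z = v + T v'" using T(2) by blast
      \<comment> \<open>Solve \<open>a + c = v\<close> and \<open>T a - T c = T v'\<close> for \<open>a, c \<in> V\<close>.\<close>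
      define a where "a = (1/2) *\<^sub>R (v + v')"
      define c where "c = (1/2) *\<^sub>R (v - v')"
      have "a \<in> V" "c \<in> V" using v subV
        by (auto simp: a_def c_def intro!: subspace_scale subspace_add subspace_diff)
      moreover have "a + c = v" and "a - c = v'"
        by (simp_all add: a_def c_def flip: scaleR_right_distrib scaleR_right_diff_distrib)
      then have "A a + C c = z"
        using v(3) linear_diff[OF T(1), of a c] by (simp add: A_def C_def algebra_simps)
      ultimately show ?thesis by blast
    qed
    then have "{x + y | x y. x \<in> A ` V \<and> y \<in> C ` V} = UNIV" by blast
    ultimately show ?thesis
      using linear_subspace_image[OF linA subV] linear_subspace_image[OF linC subV]
      by (simp add: direct_sum_decomposition_def)
  qed
  ultimately show ?thesis
    unfolding neutral_metric_def using g gAC pos neg by blast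
qed

section \<open>Isotropic abelian ideals are parallel\<close>

lemma totally_isotropicD:
  assumes "totally_isotropic g W" "x \<in> W" "y \<in> W"
  shows "g x y = 0"
  using assms by (auto simp: totally_isotropic_def orth_def)

text \<open>Membership in \<open>h\<close> is orthogonality to \<open>h\<close>, and there every term of the Koszul formula vanishes.
  The equality \<open>h = orth g h\<close> is essential: for \<open>h\<close> that is merely isotropic the same computation
  yields only a value orthogonal to \<open>h\<close>.\<close>

lemma levi_civita_mem_isotropic_abelian_ideal:
  fixes br :: "'a::real_vector \<Rightarrow> 'a \<Rightarrow> 'a"
  assumes dim: "dim (UNIV :: 'a set) > 0"
    and br: "lie_algebra_on UNIV br" and g: "pseudo_riemannian_metric g"
    and h: "abelian_ideal br h" and iso: "totally_isotropic g h" and w: "w \<in> h"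
  shows "levi_civita br g y w \<in> h"
proof -
  have bil: "bilinear g" using g by (simp add: pseudo_riemannian_metric_def)
  have anti: "br z y = - br y z" for z
  proof -
    have alt: "br x x = 0" and add: "br (x + x') u = br x u + br x' u"
      "br u (x + x') = br u x + br u x'" for x x' u
      using br by (auto simp: lie_algebra_on_def)
    have "br (z + y) (z + y) = (br z z + br z y) + (br y z + br y y)"
      using add(1)[of z y "z + y"] add(2)[of z z y] add(2)[of y z y] by simp
    then have "br (z + y) (z + y) = br z y + br y z" by (simp only: alt[of y] alt[of z] add_0_left add_0_right)
    then show ?thesis using alt[of "z + y"] by (simp add: eq_neg_iff_add_eq_0)
  qed
  have "g (levi_civita br g y w) z = 0" if z: "z \<in> h" for z
  proof -
    have "br y w \<in> h" "br z y \<in> h" "br w z = 0"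
      using h w z anti[of z] subspace_neg[of h] by (auto simp: abelian_ideal_def)
    then show ?thesis
      using levi_civita_koszul[OF dim br g, of y w z] totally_isotropicD[OF iso] w z
      by (simp add: bilinear_lzero[OF bil])
  qed
  then show ?thesis using iso by (auto simp: totally_isotropic_def orth_def)
qed

theorem corollary4p3:
  fixes br :: "'a::real_vector \<Rightarrow> 'a \<Rightarrow> 'a"
    and J :: "'a \<Rightarrow> 'a"
    and \<omega> g :: "'a \<Rightarrow> 'a \<Rightarrow> real"
  assumes "dim (UNIV :: 'a set) = 4"
    and "kahler_lie_algebra br J \<omega>"
    and "g = pseudo_kahler_metric J \<omega>"
    and "\<exists>h k brk p.
           abelian_ideal br h \<and>
           direct_sum_decomposition h k \<and>
           lie_short_exact h br (\<lambda>x. x) UNIV br p k brk \<and> (\<forall>x\<in>k. p x = x) \<and>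
           J ` h \<subseteq> h \<and> J ` k \<subseteq> k \<and>
           totally_isotropic g h \<and> totally_isotropic g k"
  shows "neutral_metric g \<and> walker_metric br g"
proof -
  obtain h k where h: "abelian_ideal br h" and dec: "direct_sum_decomposition h k"
    and isoh: "totally_isotropic g h" and isok: "totally_isotropic g k"
    using assms(4) by blast
  have dim: "dim (UNIV :: 'a set) > 0" using assms(1) by simp
  have g: "pseudo_riemannian_metric g"
    using pseudo_riemannian_pseudo_kahler_metric[OF assms(2)] assms(3) by simp
  have br: "lie_algebra_on UNIV br" using assms(2) by (simp add: kahler_lie_algebra_def)
  have "neutral_metric g"
    using neutral_metric_of_isotropic_decomposition[OF dim g dec]
      totally_isotropicD[OF isoh] totally_isotropicD[OF isok] by blast
  moreover have "h \<noteq> {0}"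
  proof
    \<comment> \<open>The zero space is orthogonal to everything, so it equals its orthogonal space only in
      dimension zero.\<close>
    assume "h = {0}"
    moreover have "g x 0 = 0" for x
      using g bilinear_rzero[of g] unfolding pseudo_riemannian_metric_def by blast
    ultimately have "(UNIV :: 'a set) = {0}"
      using isoh by (auto simp: totally_isotropic_def orth_def)
    moreover have "dim {0::'a} = 0"
      using dim_eq_card_independent[of "{} :: 'a set"] dim_span[of "{} :: 'a set"]
      by (simp add: independent_empty)
    ultimately show False using dim by simp
  qed
  moreover have "subspace h" using h by (simp add: abelian_ideal_def)
  ultimately show ?thesis
    unfolding walker_metric_def
    using g totally_isotropicD[OF isoh] levi_civita_mem_isotropic_abelian_ideal[OF dim br g h isoh]
    by blast
qed

end
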